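(* Consider any financial network with non-negative external assets, debt contracts only, and default costs $\alpha,\beta\in[0,1]$, and any profile $\mathbf{s}$ of priority-proportional strategies. Then there exist maximal (proper) clearing payments consistent with $\mathbf{s}$; that is, there exist proper clearing payments $\mathbf{P}^*$ consistent with $\mathbf{s}$ such that $p^*_{ij}\ge p_{ij}$ for all $i,j$ and all proper clearing payments $\mathbf{P}$ consistent with $\mathbf{s}$.
   Context: Financial network: firms $v_1,\dots,v_n$; each $v_i$ has external assets $e_i\ge 0$; $v_i$ owes $v_j$ the liability $l_{ij}\ge 0$, with $l_{ii}=0$ (both $l_{ij}>0$ and $l_{ji}>0$ are allowed); $L_i=\sum_j l_{ij}$. Default costs are numbers $\alpha,\beta\in[0,1]$: a firm in default can use only an $\alpha$ fraction of its external assets and a $\beta$ fraction of its incoming payments. Priority-proportional strategy: a strategy $s_i$ of $v_i$ is a complete ordering, allowing ties, of its creditors, i.e. an ordered partition of $\{v_j: l_{ij}>0\}$ into priority classes $1,2,\dots$. Write $L_i^{(m)}$ for the total liability of $v_i$ to its $m$-th class, $k_{ij}$ for the index of the class of $v_i$ containing $v_j$, and $\pi'_{ij}=l_{ij}/L_i^{(k_{ij})}$ (and $\pi'_{ij}=0$ if $L_i^{(k_{ij})}=0$). Clearing payments consistent with a strategy profile $\mathbf{s}=(s_1,\dots,s_n)$: a matrix $\mathbf{P}=(p_{ij})$ with $p_{ii}=0$, $0\le p_{ij}\le l_{ij}$ and, writing $p_i=\sum_j p_{ij}$, for every $i$: $p_i=L_i$ if $L_i\le e_i+\sum_j p_{ji}$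 (the firm is solvent), and $p_i=\alpha e_i+\beta\sum_j p_{ji}$ otherwise (the firm is in default); moreover for every creditor $v_j$ of $v_i$, $$p_{ij}=\min\Big\{\max\Big\{\Big(p_i-\sum_{m=1}^{k_{ij}-1}L_i^{(m)}\Big)\pi'_{ij},\,0\Big\},\,l_{ij}\Big\},$$ and $p_{ij}=0$ if $l_{ij}=0$. Clearing payments are proper if all money circulating originates from firms with positive external assets: every firm with a positive outgoing payment is reachable, by a (possibly trivial) directed path of edges $(v_i,v_j)$ with $p_{ij}>0$, from some firm with positive external assets. *)

theory Defs
  imports Complex_Main "HOL-Library.Disjoint_Sets"
begin

text \<open>
  The firms are the elements of a finite type. A network is given by the external assets \<open>e\<close>, the
  liabilities \<open>l\<close> (with \<open>l i j\<close> owed by \<open>i\<close> to \<open>j\<close>) and the default costs \<open>\<alpha>\<close>, \<open>\<beta>\<close>.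
\<close>

definition financial_network ::
  "('v::finite \<Rightarrow> real) \<Rightarrow> ('v \<Rightarrow> 'v \<Rightarrow> real) \<Rightarrow> real \<Rightarrow> real \<Rightarrow> bool" where
  "financial_network e l \<alpha> \<beta> \<longleftrightarrow>
     (\<forall>i. 0 \<le> e i) \<and> (\<forall>i j. 0 \<le> l i j) \<and> (\<forall>i. l i i = 0) \<and> \<alpha> \<in> {0..1} \<and> \<beta> \<in> {0..1}"

definition total_liability :: "('v::finite \<Rightarrow> 'v \<Rightarrow> real) \<Rightarrow> 'v \<Rightarrow> real" where
  "total_liability l i = (\<Sum>j\<in>UNIV. l i j)"

definition creditors :: "('v \<Rightarrow> 'v \<Rightarrow> real) \<Rightarrow> 'v \<Rightarrow> 'v set" where
  "creditors l i = {j. l i j > 0}"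

text \<open>
  An ordered partition is the list of its (nonempty, pairwise disjoint) classes, highest priority
  first. The \<open>m\<close>-th class, counted from 1, is thus the list element at position \<open>m - 1\<close>.
\<close>

definition priority_strategy :: "('v \<Rightarrow> 'v \<Rightarrow> real) \<Rightarrow> 'v \<Rightarrow> 'v set list \<Rightarrow> bool" where
  "priority_strategy l i cs \<longleftrightarrow> distinct cs \<and> partition_on (creditors l i) (set cs)"

definition class_liability ::
  "('v \<Rightarrow> 'v \<Rightarrow> real) \<Rightarrow> ('v \<Rightarrow> 'v set list) \<Rightarrow> 'v \<Rightarrow> nat \<Rightarrow> real" where
  "class_liability l s i m = (\<Sum>j\<in>s i ! (m - 1). l i j)"

text \<open>Only meaningful if \<open>j\<close> is a creditor of \<open>i\<close>; it is used only in that case.\<close>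

definition class_index :: "('v \<Rightarrow> 'v set list) \<Rightarrow> 'v \<Rightarrow> 'v \<Rightarrow> nat" where
  "class_index s i j = (THE k. k \<in> {1..length (s i)} \<and> j \<in> s i ! (k - 1))"

definition relative_liability ::
  "('v \<Rightarrow> 'v \<Rightarrow> real) \<Rightarrow> ('v \<Rightarrow> 'v set list) \<Rightarrow> 'v \<Rightarrow> 'v \<Rightarrow> real" where
  "relative_liability l s i j =
     (if class_liability l s i (class_index s i j) = 0 then 0
      else l i j / class_liability l s i (class_index s i j))"

definition outgoing :: "('v::finite \<Rightarrow> 'v \<Rightarrow> real) \<Rightarrow> 'v \<Rightarrow> real" where
  "outgoing P i = (\<Sum>j\<in>UNIV. P i j)"

definition incoming :: "('v::finite \<Rightarrow> 'v \<Rightarrow> real) \<Rightarrow> 'v \<Rightarrow> real" where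
  "incoming P i = (\<Sum>j\<in>UNIV. P j i)"

definition clearing_payments ::
  "('v::finite \<Rightarrow> real) \<Rightarrow> ('v \<Rightarrow> 'v \<Rightarrow> real) \<Rightarrow> real \<Rightarrow> real \<Rightarrow> ('v \<Rightarrow> 'v set list) \<Rightarrow>
   ('v \<Rightarrow> 'v \<Rightarrow> real) \<Rightarrow> bool" where
  "clearing_payments e l \<alpha> \<beta> s P \<longleftrightarrow>
     (\<forall>i. P i i = 0) \<and>
     (\<forall>i j. 0 \<le> P i j \<and> P i j \<le> l i j) \<and>
     (\<forall>i. outgoing P i =
            (if total_liability l i \<le> e i + incoming P i then total_liability l i
             else \<alpha> * e i + \<beta> * incoming P i)) \<and>
     (\<forall>i. \<forall>j\<in>creditors l i.
        P i j = min (max ((outgoing P i - (\<Sum>m = 1..class_index s i j - 1. class_liability l s i m))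
                            * relative_liability l s i j) 0)
                    (l i j)) \<and>
     (\<forall>i j. l i j = 0 \<longrightarrow> P i j = 0)"

definition proper_payments :: "('v::finite \<Rightarrow> real) \<Rightarrow> ('v \<Rightarrow> 'v \<Rightarrow> real) \<Rightarrow> bool" where
  "proper_payments e P \<longleftrightarrow>
     (\<forall>i. outgoing P i > 0 \<longrightarrow> (\<exists>u. e u > 0 \<and> (\<lambda>v w. P v w > 0)\<^sup>*\<^sup>* u i))"

end

theory Submission
  imports Defs
begin

text \<open>
  Given total payments \<open>x\<close>, the strategies determine the individual payments, monotonically in \<open>x\<close>
  and with row sums \<open>x\<close>. So clearing payments correspond to the fixed points of a monotone operator
  on the box between \<open>0\<close> and the total liabilities, and Knaster--Tarski yields the greatest clearing
  payments. Now delete all payments of the firms outside the set \<open>R\<close> of firms reachable from positive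
  external assets. Firms outside \<open>R\<close> have no external assets and receive nothing from \<open>R\<close>, so
  together they cannot pay more than they pay to each other: they pay nothing to \<open>R\<close>. Hence the
  payments that remain are still clearing, and they are proper. The payments of a proper matrix below
  the greatest one all start in \<open>R\<close> and so are bounded by what remains.
\<close>

section \<open>Greatest fixed points on an order interval\<close>

text \<open>Knaster-Tarski for functions into a lattice that, like the reals, is only conditionally
  complete: the supremum of the post-fixed points is taken pointwise, and it exists because
  \<open>a\<close> is one of them and \<open>b\<close> bounds them all.\<close>

lemma greatest_fixpoint_between:
  fixes F :: "('a \<Rightarrow> 'b::conditionally_complete_lattice) \<Rightarrow> 'a \<Rightarrow> 'b"
  assumes mono: "\<And>x y. a \<le> x \<Longrightarrow> x \<le> y \<Longrightarrow> y \<le> b \<Longrightarrow> F x \<le> F y"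
    and "a \<le> b" "a \<le> F a" "F b \<le> b"
  obtains z where "a \<le> z" "z \<le> b" "F z = z" "\<And>y. a \<le> y \<Longrightarrow> y \<le> b \<Longrightarrow> y \<le> F y \<Longrightarrow> y \<le> z"
proof
  define A where "A = {y. a \<le> y \<and> y \<le> b \<and> y \<le> F y}"
  define z where "z = (\<lambda>i. SUP y\<in>A. y i)"
  have "a \<in> A"
    using assms by (simp add: A_def)
  have bdd: "bdd_above ((\<lambda>y. y i) ` A)" for i
    by (rule bdd_aboveI[of _ "b i"]) (auto simp: A_def le_fun_def)
  have upper: "y \<le> z" if "y \<in> A" for y
    unfolding z_def le_fun_def by (intro allI cSUP_upper that bdd)
  have least: "z \<le> w" if "\<And>y. y \<in> A \<Longrightarrow> y \<le> w" for w
    unfolding z_def le_fun_def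
    using that \<open>a \<in> A\<close> by (intro allI cSUP_least) (auto simp: le_fun_def)
  show az: "a \<le> z" and zb: "z \<le> b"
    using upper[OF \<open>a \<in> A\<close>] by (auto intro: least simp: A_def)
  have zF: "z \<le> F z"
  proof (rule least)
    fix y assume y: "y \<in> A"
    then have "y \<le> F y" "F y \<le> F z"
      using upper[OF y] mono zb by (auto simp: A_def)
    then show "y \<le> F z" by (rule order_trans)
  qed
  \<comment> \<open>Monotonicity gives \<open>F z \<le> F b \<le> b\<close> and
    \<open>F z \<le> F (F z)\<close>, so \<open>F z\<close> is itself a post-fixed point and hence
    below \<open>z\<close>.\<close>
  have "F z \<in> A"
    using az zb zF mono[OF az zb] mono[OF az zF] \<open>F b \<le> b\<close> unfolding A_def
    by (auto intro: order_trans)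
  then show "F z = z"
    using zF upper by (auto intro: antisym)
  show "y \<le> z" if "a \<le> y" "y \<le> b" "y \<le> F y" for y
    using that upper by (simp add: A_def)
qed

section \<open>Payments prescribed by a priority strategy\<close>

text \<open>Pouring an amount \<open>x\<close> into buckets of capacities \<open>c k\<close> in
  turn: each bucket takes what its predecessors left over, up to its capacity, so together they hold
  \<open>x\<close> or are all full.\<close>

lemma sum_min_partial_sums:
  fixes c :: "nat \<Rightarrow> real"
  assumes "\<And>k. k < n \<Longrightarrow> 0 \<le> c k" "0 \<le> x"
  shows "(\<Sum>k<n. min (max (x - (\<Sum>m<k. c m)) 0) (c k)) = min x (\<Sum>k<n. c k)"
  using assms
proof (induction n)
  case (Suc n)
  have "(\<Sum>k<n. min (max (x - (\<Sum>m<k. c m)) 0) (c k)) = min x (\<Sum>k<n. c k)" "0 \<le> c n"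
    using Suc by simp_all
  then show ?case by (simp add: min_def max_def)
qed simp

lemma sum_creditors:
  fixes l :: "'v::finite \<Rightarrow> 'v \<Rightarrow> real"
  assumes "priority_strategy l i cs"
  shows "(\<Sum>j\<in>creditors l i. f j) = (\<Sum>k<length cs. \<Sum>j\<in>cs ! k. f j)"
proof -
  have "distinct cs" and part: "partition_on (creditors l i) (set cs)"
    using assms by (auto simp: priority_strategy_def)
  have "(\<Sum>j\<in>creditors l i. f j) = (\<Sum>A\<in>set cs. \<Sum>j\<in>A. f j)"
    using sum.Union_disjoint_sets[of "set cs" f] partition_onD1[OF part] partition_onD2[OF part]
    by simp
  also have "\<dots> = (\<Sum>k<length cs. \<Sum>j\<in>cs ! k. f j)"
    by (rule sum.reindex_bij_betw[symmetric]) (simp add: bij_betw_nth \<open>distinct cs\<close>)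
  finally show ?thesis .
qed

text \<open>The classes are disjoint and listed without repetition, so the definite description has
  a unique solution. The successor arises because classes count from 1 and list positions from
  0.\<close>

lemma class_index_eq:
  assumes "priority_strategy l i (s i)" "k < length (s i)" "j \<in> s i ! k"
  shows "class_index s i j = Suc k"
  unfolding class_index_def
proof (rule the_equality)
  fix m assume m: "m \<in> {1..length (s i)} \<and> j \<in> s i ! (m - 1)"
  have "disjoint (set (s i))" "distinct (s i)"
    using assms by (auto simp: priority_strategy_def partition_on_def)
  moreover have "s i ! (m - 1) \<in> set (s i)" "s i ! k \<in> set (s i)"
    using m assms by auto
  ultimately have "s i ! (m - 1) = s i ! k"
    using m assms by (metis disjointD disjoint_iff)
  then have "m - 1 = k"
    using m assms \<open>distinct (s i)\<close> by (auto simp: nth_eq_iff_index_eq)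
  then show "m = Suc k"
    using m by auto
qed (use assms in auto)

text \<open>The total payment becomes a free argument \<open>x\<close>, so that the payment rule is
  a function of one number per firm. The value 0 off the creditors builds in the condition for zero
  liabilities.\<close>

definition priority_payment ::
  "('v \<Rightarrow> 'v \<Rightarrow> real) \<Rightarrow> ('v \<Rightarrow> 'v set list) \<Rightarrow> 'v \<Rightarrow> real \<Rightarrow> 'v \<Rightarrow> real" where
  "priority_payment l s i x j =
     (if j \<in> creditors l i
      then min (max ((x - (\<Sum>m = 1..class_index s i j - 1. class_liability l s i m))
                       * relative_liability l s i j) 0)
               (l i j)
      else 0)"

lemma class_liability_nonneg: "(\<And>j. 0 \<le> l i j) \<Longrightarrow> 0 \<le> class_liability l s i m"
  by (simp add: class_liability_def sum_nonneg)

lemma relative_liability_nonneg: "(\<And>j. 0 \<le> l i j) \<Longrightarrow> 0 \<le> relative_liability l s i j"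
  by (simp add: relative_liability_def class_liability_nonneg)

lemma priority_payment_mono:
  assumes "\<And>j. 0 \<le> l i j" "x \<le> y"
  shows "priority_payment l s i x j \<le> priority_payment l s i y j"
proof -
  have "(x - S) * relative_liability l s i j \<le> (y - S) * relative_liability l s i j" for S
    using assms by (intro mult_right_mono relative_liability_nonneg) auto
  then show ?thesis
    unfolding priority_payment_def by (auto intro!: min.coboundedI1 max.mono)
qed

lemma priority_payment_nonneg: "(\<And>j. 0 \<le> l i j) \<Longrightarrow> 0 \<le> priority_payment l s i x j"
  by (simp add: priority_payment_def)

lemma priority_payment_le: "(\<And>j. 0 \<le> l i j) \<Longrightarrow> priority_payment l s i x j \<le> l i j"
  by (simp add: priority_payment_def)

text \<open>For a firm whose payments are all deleted, this shows that the resulting zero row still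
  follows the strategy.\<close>

lemma priority_payment_0:
  assumes "\<And>j. 0 \<le> l i j"
  shows "priority_payment l s i 0 j = 0"
proof -
  have "(0 - (\<Sum>m = 1..class_index s i j - 1. class_liability l s i m))
          * relative_liability l s i j \<le> 0"
    using assms
    by (intro mult_nonpos_nonneg relative_liability_nonneg)
      (simp_all add: sum_nonneg class_liability_nonneg)
  then show ?thesis
    using assms by (simp add: priority_payment_def)
qed

lemma total_liability_creditors:
  assumes "\<And>j. 0 \<le> l i j"
  shows "total_liability l i = (\<Sum>j\<in>creditors l i. l i j)"
  unfolding total_liability_def
  by (rule sum.mono_neutral_right)
    (use assms in \<open>auto simp: creditors_def order.strict_iff_order\<close>)

text \<open>The creditors in a class share one common amount in the proportions
  \<open>l i j / c\<close>, which sum to 1. Here \<open>c > 0\<close>, since a class is nonempty and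
  consists of creditors.\<close>

lemma class_sum_priority_payment:
  fixes l :: "'v::finite \<Rightarrow> 'v \<Rightarrow> real"
  assumes strat: "priority_strategy l i (s i)" and k: "k < length (s i)"
  shows "(\<Sum>j\<in>s i ! k. priority_payment l s i x j) =
    min (max (x - (\<Sum>m<k. class_liability l s i (Suc m))) 0) (class_liability l s i (Suc k))"
    (is "_ = ?t")
proof -
  define c where "c = class_liability l s i (Suc k)"
  define S where "S = (\<Sum>m<k. class_liability l s i (Suc m))"
  have mem: "s i ! k \<in> set (s i)" and part: "partition_on (creditors l i) (set (s i))"
    using assms by (auto simp: priority_strategy_def)
  then have sub: "s i ! k \<subseteq> creditors l i" and ne: "s i ! k \<noteq> {}"
    by (auto simp: partition_on_def)
  have c_sum: "c = (\<Sum>j\<in>s i ! k. l i j)"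
    by (simp add: c_def class_liability_def)
  have "c > 0"
    unfolding c_sum using sub ne by (intro sum_pos) (auto simp: creditors_def)
  have "priority_payment l s i x j = min (max (x - S) 0) c * (l i j / c)" if "j \<in> s i ! k" for j
  proof -
    have idx: "class_index s i j = Suc k"
      using class_index_eq[of l i s, OF strat k that] .
    have "l i j > 0"
      using that sub by (auto simp: creditors_def)
    have "(\<Sum>m = 1..k. class_liability l s i m) = S"
      unfolding S_def by (rule sum.reindex_bij_witness[of _ Suc "\<lambda>m. m - 1"]) auto
    then have "priority_payment l s i x j = min (max ((x - S) * (l i j / c)) 0) (l i j)"
      using idx \<open>c > 0\<close> that sub c_def
      by (auto simp: priority_payment_def relative_liability_def)
    \<comment> \<open>Both bounds are written as multiples of the positive factor
      \<open>l i j / c\<close>, which can then be pulled out of \<open>min\<close> and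
      \<open>max\<close>.\<close>
    also have "\<dots> = min (max ((x - S) * (l i j / c)) (0 * (l i j / c))) (c * (l i j / c))"
      using \<open>c > 0\<close> by simp
    also have "\<dots> = min (max (x - S) 0) c * (l i j / c)"
      using \<open>c > 0\<close> \<open>l i j > 0\<close>
      by (simp only: min_mult_distrib_right max_mult_distrib_right) simp
    finally show ?thesis .
  qed
  then have "(\<Sum>j\<in>s i ! k. priority_payment l s i x j)
      = (\<Sum>j\<in>s i ! k. min (max (x - S) 0) c * (l i j / c))"
    by (rule sum.cong[OF refl])
  also have "\<dots> = min (max (x - S) 0) c * (c / c)"
    by (simp only: c_sum sum_distrib_left sum_divide_distrib)
  finally show ?thesis
    using \<open>c > 0\<close> by (simp add: c_def S_def)
qed

text \<open>The class totals fill up as buckets whose capacities add up to the total liability; as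
  \<open>x\<close> does not exceed it, all of \<open>x\<close> is paid out.\<close>

lemma sum_priority_payment:
  fixes l :: "'v::finite \<Rightarrow> 'v \<Rightarrow> real"
  assumes strat: "priority_strategy l i (s i)" and nonneg: "\<And>j. 0 \<le> l i j"
    and x: "0 \<le> x" "x \<le> total_liability l i"
  shows "(\<Sum>j\<in>UNIV. priority_payment l s i x j) = x"
proof -
  have "total_liability l i = (\<Sum>k<length (s i). class_liability l s i (Suc k))"
    using total_liability_creditors[of l i, OF nonneg] sum_creditors[OF strat, of "l i"]
    by (simp add: class_liability_def)
  moreover have "(\<Sum>j\<in>UNIV. priority_payment l s i x j)
      = (\<Sum>j\<in>creditors l i. priority_payment l s i x j)"
    by (rule sum.mono_neutral_right) (auto simp: priority_payment_def)
  ultimately show ?thesis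
    using x sum_min_partial_sums[of "length (s i)" "\<lambda>k. class_liability l s i (Suc k)" x]
      class_liability_nonneg[of l i, OF nonneg]
    by (simp add: sum_creditors[OF strat] class_sum_priority_payment[of l i s, OF strat])
qed

section \<open>Clearing payments as fixed points\<close>

definition disposable ::
  "('v::finite \<Rightarrow> real) \<Rightarrow> ('v \<Rightarrow> 'v \<Rightarrow> real) \<Rightarrow> real \<Rightarrow> real \<Rightarrow> ('v \<Rightarrow> 'v \<Rightarrow> real) \<Rightarrow> 'v \<Rightarrow> real" where
  "disposable e l \<alpha> \<beta> P i =
     (if total_liability l i \<le> e i + incoming P i then total_liability l i
      else \<alpha> * e i + \<beta> * incoming P i)"

text \<open>The other clearing conditions follow from the payment rule: its cuts at 0 and
  \<open>l i j\<close> give the bounds, which force zeros wherever the liability is zero, in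
  particular on the diagonal.\<close>

lemma clearing_payments_iff:
  fixes l :: "'v::finite \<Rightarrow> 'v \<Rightarrow> real"
  assumes "financial_network e l \<alpha> \<beta>"
  shows "clearing_payments e l \<alpha> \<beta> s P \<longleftrightarrow>
    (\<forall>i. outgoing P i = disposable e l \<alpha> \<beta> P i) \<and>
    (\<forall>i j. P i j = priority_payment l s i (outgoing P i) j)"
    (is "_ \<longleftrightarrow> ?out \<and> ?pay")
proof
  have nonneg: "0 \<le> l i j" and diag: "l i i = 0" for i j
    using assms by (auto simp: financial_network_def)
  {
    assume "clearing_payments e l \<alpha> \<beta> s P"
    moreover have "l i j = 0" if "j \<notin> creditors l i" for i j
      using that nonneg[of i j] by (auto simp: creditors_def)
    ultimately show "?out \<and> ?pay"
      by (auto simp: clearing_payments_def disposable_def priority_payment_def)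
  next
    assume R: "?out \<and> ?pay"
    then have bounds: "0 \<le> P i j" "P i j \<le> l i j" for i j
      using priority_payment_nonneg[of l i, OF nonneg] priority_payment_le[of l i, OF nonneg]
      by (metis, metis)
    then have "P i j = 0" if "l i j = 0" for i j
      using that by (metis order_antisym)
    moreover have "\<forall>i. \<forall>j\<in>creditors l i.
        P i j = min (max ((outgoing P i - (\<Sum>m = 1..class_index s i j - 1. class_liability l s i m))
                            * relative_liability l s i j) 0)
                    (l i j)"
      using R unfolding priority_payment_def by (metis (full_types))
    ultimately show "clearing_payments e l \<alpha> \<beta> s P"
      using R bounds diag by (simp add: clearing_payments_def disposable_def)
  }
qed

lemma disposable_nonneg:
  assumes "financial_network e l \<alpha> \<beta>" "\<And>i j. 0 \<le> P i j"
  shows "0 \<le> disposable e l \<alpha> \<beta> P i"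
  using assms
  by (auto simp: disposable_def financial_network_def total_liability_def incoming_def sum_nonneg)

lemma default_le:
  assumes "financial_network e l \<alpha> \<beta>" "\<And>i j. 0 \<le> P i j"
  shows "\<alpha> * e i + \<beta> * incoming P i \<le> e i + incoming P i"
  using assms
  by (intro add_mono mult_left_le_one_le)
    (auto simp: financial_network_def incoming_def sum_nonneg)

lemma disposable_le:
  assumes "financial_network e l \<alpha> \<beta>" "\<And>i j. 0 \<le> P i j"
  shows "disposable e l \<alpha> \<beta> P i \<le> total_liability l i"
  using default_le[of e l \<alpha> \<beta> P i, OF assms] by (simp add: disposable_def)

text \<open>Default costs can only destroy money. This drives the accounting for firms cut off from
  external assets.\<close>

lemma disposable_le_assets:
  assumes "financial_network e l \<alpha> \<beta>" "\<And>i j. 0 \<le> P i j"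
  shows "disposable e l \<alpha> \<beta> P i \<le> e i + incoming P i"
  using default_le[of e l \<alpha> \<beta> P i, OF assms] by (simp add: disposable_def)

text \<open>The critical case is a firm in default under \<open>P\<close> and solvent under
  \<open>Q\<close>: its payment jumps, but upwards, as a defaulting firm never pays more than it
  owes.\<close>

lemma disposable_mono:
  assumes fn: "financial_network e l \<alpha> \<beta>" and "\<And>i j. 0 \<le> P i j" "\<And>i j. P i j \<le> Q i j"
  shows "disposable e l \<alpha> \<beta> P i \<le> disposable e l \<alpha> \<beta> Q i"
proof -
  have inc: "incoming P i \<le> incoming Q i"
    unfolding incoming_def by (intro sum_mono assms)
  moreover have "\<beta> * incoming P i \<le> \<beta> * incoming Q i"
    using inc fn by (intro mult_left_mono) (auto simp: financial_network_def)
  ultimately show ?thesis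
    using disposable_le[of e l \<alpha> \<beta> P i, OF assms(1,2)] by (auto simp: disposable_def)
qed

lemma greatest_clearing_payments:
  fixes l :: "'v::finite \<Rightarrow> 'v \<Rightarrow> real"
  assumes fn: "financial_network e l \<alpha> \<beta>" and strat: "\<And>i. priority_strategy l i (s i)"
  obtains P where "clearing_payments e l \<alpha> \<beta> s P"
    "\<And>Q i j. clearing_payments e l \<alpha> \<beta> s Q \<Longrightarrow> Q i j \<le> P i j"
proof -
  have nonneg: "0 \<le> l i j" for i j
    using fn by (auto simp: financial_network_def)
  define pay where "pay = (\<lambda>x i. priority_payment l s i (x i))"
  define F where "F = (\<lambda>x. disposable e l \<alpha> \<beta> (pay x))"
  have pay_nonneg: "0 \<le> pay x i j" for x i j
    by (simp add: pay_def priority_payment_nonneg nonneg)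
  have pay_mono: "pay x i j \<le> pay y i j" if "x \<le> y" for x y i j
    using that by (simp add: pay_def priority_payment_mono nonneg le_fun_def)
  \<comment> \<open>On this interval \<open>x\<close> is recovered from \<open>pay x\<close>, so a
    fixed point of \<open>F\<close> yields clearing payments.\<close>
  have outgoing_pay: "outgoing (pay x) = x"
    if "(\<lambda>_. 0) \<le> x" "x \<le> total_liability l" for x
    using that sum_priority_payment[of l i s "x i" for i, OF strat nonneg]
    by (auto simp: outgoing_def pay_def le_fun_def)
  have range: "(\<lambda>_. 0) \<le> F x" "F x \<le> total_liability l" for x
    by (simp_all add: F_def le_fun_def disposable_nonneg disposable_le fn pay_nonneg)
  have "F x \<le> F y" if "x \<le> y" for x y
    unfolding F_def le_fun_def
    by (intro allI disposable_mono fn pay_nonneg pay_mono that)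
  moreover have "(\<lambda>_. 0) \<le> total_liability l"
    by (simp add: le_fun_def total_liability_def sum_nonneg nonneg)
  ultimately obtain z where z: "(\<lambda>_. 0) \<le> z" "z \<le> total_liability l" "F z = z"
    and greatest: "\<And>y. (\<lambda>_. 0) \<le> y \<Longrightarrow> y \<le> total_liability l \<Longrightarrow> y \<le> F y \<Longrightarrow> y \<le> z"
    by (rule greatest_fixpoint_between[of "\<lambda>_. 0" "total_liability l" F]) (auto simp: range)
  show thesis
  proof
    show "clearing_payments e l \<alpha> \<beta> s (pay z)"
      using z(3) unfolding clearing_payments_iff[OF fn] outgoing_pay[OF z(1,2)]
      by (simp add: F_def pay_def fun_eq_iff)
  next
    fix Q i j assume Q: "clearing_payments e l \<alpha> \<beta> s Q"
    then have pay: "pay (outgoing Q) = Q" and out: "outgoing Q = disposable e l \<alpha> \<beta> Q"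
      unfolding clearing_payments_iff[OF fn] by (simp_all add: pay_def fun_eq_iff)
    then have "F (outgoing Q) = outgoing Q"
      by (simp add: F_def)
    \<comment> \<open>As a value of \<open>F\<close>, the vector \<open>outgoing Q\<close> lies in
      the interval by \<open>range\<close>.\<close>
    then have "outgoing Q \<le> z"
      using greatest range by (metis order_refl)
    then show "Q i j \<le> pay z i j"
      using pay_mono pay by metis
  qed
qed

section \<open>Restriction to firms reachable from external assets\<close>

definition reachable :: "('v \<Rightarrow> real) \<Rightarrow> ('v \<Rightarrow> 'v \<Rightarrow> real) \<Rightarrow> 'v set" where
  "reachable e P = {i. \<exists>u. e u > 0 \<and> (\<lambda>v w. P v w > 0)\<^sup>*\<^sup>* u i}"

lemma reachable_step: "i \<in> reachable e P \<Longrightarrow> P i j > 0 \<Longrightarrow> j \<in> reachable e P"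
  unfolding reachable_def by (auto intro: rtranclp.rtrancl_into_rtrancl)

lemma reachable_mono:
  assumes "\<And>i j. P i j \<le> Q i j"
  shows "reachable e P \<subseteq> reachable e Q"
proof -
  have "(\<lambda>v w. P v w > 0)\<^sup>*\<^sup>* \<le> (\<lambda>v w. Q v w > 0)\<^sup>*\<^sup>*"
    using assms by (intro rtranclp_mono) (auto intro: less_le_trans)
  then show ?thesis
    unfolding reachable_def by blast
qed

definition restrict_reachable :: "('v \<Rightarrow> real) \<Rightarrow> ('v \<Rightarrow> 'v \<Rightarrow> real) \<Rightarrow> 'v \<Rightarrow> 'v \<Rightarrow> real" where
  "restrict_reachable e P i j = (if i \<in> reachable e P then P i j else 0)"

lemma proper_restrict_reachable: "proper_payments e (restrict_reachable e P)"
proof -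
  let ?P = "restrict_reachable e P"
  \<comment> \<open>Every firm on such a path is itself reachable, so none of the path's edges is
    deleted.\<close>
  have path: "(\<lambda>v w. ?P v w > 0)\<^sup>*\<^sup>* u i" if "(\<lambda>v w. P v w > 0)\<^sup>*\<^sup>* u i" "e u > 0" for u i
    using that
  proof (induction rule: rtranclp_induct)
    case (step v w)
    then have "?P v w > 0"
      by (auto simp: restrict_reachable_def reachable_def)
    with step show ?case
      by (auto intro: rtranclp.rtrancl_into_rtrancl)
  qed simp
  have "i \<in> reachable e P" if "outgoing ?P i > 0" for i
    using that by (rule contrapos_pp) (simp add: outgoing_def restrict_reachable_def)
  then show ?thesis
    unfolding proper_payments_def using path unfolding reachable_def by blast
qed

lemma no_payment_into_reachable:
  assumes fn: "financial_network e l \<alpha> \<beta>" and P: "clearing_payments e l \<alpha> \<beta> s P"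
    and i: "i \<notin> reachable e P" and j: "j \<in> reachable e P"
  shows "P i j = 0"
proof -
  let ?R = "reachable e P"
  let ?N = "- reachable e P"
  have nonneg: "0 \<le> P i j" for i j
    using P by (simp add: clearing_payments_def)
  have "outgoing P i \<le> (\<Sum>j\<in>?N. P j i)" if "i \<in> ?N" for i
  proof -
    have "e i \<le> 0"
      using that by (auto simp: reachable_def not_less[symmetric])
    moreover have "outgoing P i \<le> e i + incoming P i"
      using disposable_le_assets[of e l \<alpha> \<beta> P i, OF fn nonneg] P
      by (simp add: clearing_payments_iff[OF fn])
    moreover have "P j i = 0" if "j \<in> ?R" for j
      using reachable_step[OF that] \<open>i \<in> ?N\<close> nonneg[of j i] by (metis ComplD order_le_less)
    then have "incoming P i = (\<Sum>j\<in>?N. P j i)"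
      unfolding incoming_def by (intro sum.mono_neutral_right) auto
    ultimately show ?thesis by simp
  qed
  then have "(\<Sum>i\<in>?N. outgoing P i) \<le> (\<Sum>i\<in>?N. \<Sum>j\<in>?N. P j i)"
    by (rule sum_mono)
  also have "\<dots> = (\<Sum>i\<in>?N. \<Sum>j\<in>?N. P i j)"
    by (rule sum.swap)
  finally have "(\<Sum>i\<in>?N. outgoing P i) \<le> (\<Sum>i\<in>?N. \<Sum>j\<in>?N. P i j)" .
  \<comment> \<open>Once outgoing payments are split by recipient, those inside \<open>?N\<close>
    cancel on both sides, leaving only the flow from \<open>?N\<close> into
    \<open>?R\<close>.\<close>
  moreover have "outgoing P i = (\<Sum>j\<in>?N. P i j) + (\<Sum>j\<in>?R. P i j)" for i
    unfolding outgoing_def using sum.union_disjoint[of ?N ?R "P i"] by simp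
  ultimately have "(\<Sum>i\<in>?N. \<Sum>j\<in>?R. P i j) \<le> 0"
    by (simp add: sum.distrib)
  then have "(\<Sum>i\<in>?N. \<Sum>j\<in>?R. P i j) = 0"
    by (intro antisym sum_nonneg nonneg)
  then show ?thesis
    using i j nonneg by (simp add: sum_nonneg_eq_0_iff sum_nonneg)
qed

lemma clearing_restrict_reachable:
  assumes fn: "financial_network e l \<alpha> \<beta>" and P: "clearing_payments e l \<alpha> \<beta> s P"
  shows "clearing_payments e l \<alpha> \<beta> s (restrict_reachable e P)"
proof -
  let ?R = "reachable e P"
  let ?P = "restrict_reachable e P"
  have nonneg: "0 \<le> l i j" "0 \<le> P i j" for i j
    using fn P by (auto simp: financial_network_def clearing_payments_def)
  have outP: "outgoing P i = disposable e l \<alpha> \<beta> P i"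
    and payP: "P i j = priority_payment l s i (outgoing P i) j" for i j
    using P unfolding clearing_payments_iff[OF fn] by blast+
  \<comment> \<open>Deleting the rows outside \<open>?R\<close> costs these firms no income, since
    those rows paid nothing into \<open>?R\<close>.\<close>
  have out_R: "outgoing ?P i = outgoing P i" and inc_R: "incoming ?P i = incoming P i"
    if "i \<in> ?R" for i
    using that no_payment_into_reachable[OF fn P]
    by (auto simp: outgoing_def incoming_def restrict_reachable_def intro!: sum.cong)
  have out_N: "outgoing ?P i = 0" and inc_N: "incoming ?P i = 0" and e_N: "e i = 0"
    if "i \<notin> ?R" for i
  proof -
    show "outgoing ?P i = 0"
      using that by (simp add: outgoing_def restrict_reachable_def)
    have "P j i = 0" if "j \<in> ?R" for j
      using reachable_step[OF that] \<open>i \<notin> ?R\<close> nonneg(2)[of j i] by (metis order_le_less)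
    then show "incoming ?P i = 0"
      by (auto simp: incoming_def restrict_reachable_def intro!: sum.neutral)
    have "\<not> e i > 0"
      using that by (auto simp: reachable_def)
    then show "e i = 0"
      using fn by (metis financial_network_def order_le_less)
  qed
  have "outgoing ?P i = disposable e l \<alpha> \<beta> ?P i" for i
  proof (cases "i \<in> ?R")
    case True
    then show ?thesis
      by (simp add: out_R outP disposable_def inc_R)
  next
    case False
    \<comment> \<open>Without assets and income a firm is solvent only if it owes exactly 0, so both
      branches of \<open>disposable\<close> give 0.\<close>
    moreover have "0 \<le> total_liability l i"
      by (simp add: total_liability_def sum_nonneg nonneg)
    ultimately show ?thesis
      by (simp add: out_N inc_N e_N disposable_def)
  qed
  moreover have "?P i j = priority_payment l s i (outgoing ?P i) j" for i j
    using payP[of i j]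
    by (cases "i \<in> ?R") (simp_all add: out_R out_N restrict_reachable_def priority_payment_0 nonneg)
  ultimately show ?thesis
    unfolding clearing_payments_iff[OF fn] by blast
qed

theorem lemma1:
  fixes e :: "'v::finite \<Rightarrow> real"
    and l :: "'v \<Rightarrow> 'v \<Rightarrow> real"
    and \<alpha> \<beta> :: real
    and s :: "'v \<Rightarrow> 'v set list"
  assumes "financial_network e l \<alpha> \<beta>"
    and "\<And>i. priority_strategy l i (s i)"
  shows "\<exists>P. clearing_payments e l \<alpha> \<beta> s P \<and> proper_payments e P \<and>
           (\<forall>Q. clearing_payments e l \<alpha> \<beta> s Q \<and> proper_payments e Q \<longrightarrow>
                (\<forall>i j. Q i j \<le> P i j))"
proof -
  obtain P where P: "clearing_payments e l \<alpha> \<beta> s P"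
    and greatest: "\<And>Q i j. clearing_payments e l \<alpha> \<beta> s Q \<Longrightarrow> Q i j \<le> P i j"
    using greatest_clearing_payments[OF assms] by blast
  have "Q i j \<le> restrict_reachable e P i j"
    if Q: "clearing_payments e l \<alpha> \<beta> s Q" "proper_payments e Q" for Q i j
  proof (cases "i \<in> reachable e P")
    case True
    then show ?thesis
      by (simp add: restrict_reachable_def greatest Q)
  next
    case False
    have nonneg: "0 \<le> Q i j" for j
      using Q by (simp add: clearing_payments_def)
    \<comment> \<open>Since \<open>Q\<close> lies below \<open>P\<close>, each path of positive
      payments in \<open>Q\<close> is one in \<open>P\<close>. Properness of \<open>Q\<close> then
      forces row \<open>i\<close> to vanish.\<close>
    have "i \<notin> reachable e Q"
      using False reachable_mono[of Q P e] greatest[OF Q(1)] by blast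
    then have "outgoing Q i \<le> 0"
      using Q(2) by (auto simp: proper_payments_def reachable_def not_less[symmetric])
    moreover have "Q i j \<le> outgoing Q i"
      unfolding outgoing_def by (rule member_le_sum) (auto simp: nonneg)
    ultimately show ?thesis
      using False by (simp add: restrict_reachable_def)
  qed
  then show ?thesis
    using clearing_restrict_reachable[OF assms(1) P] proper_restrict_reachable by blast
qed

end
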